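(* Let $\mathfrak p_1,\mathfrak p_2\in D_n^B$ have height sequences $(h^{(1)}_1,\dots,h^{(1)}_{k_1})$ and $(h^{(2)}_1,\dots,h^{(2)}_{k_2})$. Then the relative pseudocomplement $\mathfrak p_1\to\mathfrak p_2$ in $\mathcal{D}_n^B$ is the Dyck path $\mathfrak p\in D_n^B$ with height sequence $(h_1,\dots,h_k)$, where $$k=\begin{cases}k_2,& k_1<k_2, \text{ or } k_1\ge k_2 \text{ and } h^{(1)}_{k_2}>h^{(2)}_{k_2},\\ \max\{i\in[k_2-1]\mid h^{(1)}_i>h^{(2)}_i\}+1,& k_1\ge k_2\text{ and } h^{(1)}_{k_2}\le h^{(2)}_{k_2},\end{cases}$$ (with the convention $\max\emptyset=0$), and the entries are defined recursively from the right as follows. If $k_1<k_2$: $$h_i=\begin{cases}h_{i+1},& i\le k_1\text{ and } h^{(1)}_i\le h^{(2)}_i,\\ h^{(2)}_i,& i>k_1, \text{ or } i\le k_1\text{ and } h^{(1)}_i>h^{(2)}_i.\end{cases}$$ If $k_1\ge k_2$: $$h_i=\begin{cases}2n-k+1,& i=k\text{ and } h^{(1)}_k\le h^{(2)}_k,\\ h_{i+1},& i<k\text{ and } h^{(1)}_i\le h^{(2)}_i,\\ h^{(2)}_i,& i\le k\text{ and } h^{(1)}_i>h^{(2)}_i.\end{cases}$$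
   Context: $D_n^B$ is the set of words (Dyck paths of type $B$) of length $2n$ over $\{u,r\}$ in which every prefix contains at least as many $u$'s as $r$'s. Height sequence of $w\in D_n^B$: let $\rho$ be the number of $r$'s. If $w$ ends with $r$, $k=\rho$ and $h_i$ is the number of $u$'s preceding the $i$-th $r$ (then $h_k=2n-k$); if $w$ ends with $u$, $k=\rho+1$, $h_i$ ($i\le\rho$) as before and $h_k$ is the total number of $u$'s (then $h_k=2n-k+1$). These are exactly the sequences with $k\in[n]$, $h_k\in\{2n-k,2n-k+1\}$, $h_1\le\dots\le h_{k-1}\le 2n-k$ and $h_i\ge i$ for $i\in[k]$. Dominance order: $(h_1,\dots,h_k)\le_D(h'_1,\dots,h'_{k'})$ iff $k\ge k'$ and $h_i\le h'_i$ for $i\in[k']$; $\mathcal{D}_n^B=(D_n^B,\le_D)$ is a distributive lattice, whose meet of sequences of lengths $k\ge k'$ is $(\min\{h_1,h'_1\},\dots,\min\{h_{k'},h'_{k'}\},h_{k'+1},\dots,h_k)$. The relative pseudocomplement $x\to y$ is the greatest $z$ with $x\wedge z\le y$. *)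

theory Defs
  imports "HOL-Library.Sublist" "HOL-Algebra.Lattice"
begin

datatype step = Up | Rt

definition dyckB :: "nat \<Rightarrow> step list set" where
  "dyckB n = {w. length w = 2 * n \<and>
     (\<forall>v. prefix v w \<longrightarrow> count_list v Rt \<le> count_list v Up)}"

definition heights :: "step list \<Rightarrow> nat list" where
  "heights w =
     map (\<lambda>j. count_list (take j w) Up) (filter (\<lambda>j. w ! j = Rt) [0..<length w])
     @ (if w \<noteq> [] \<and> last w = Up then [count_list w Up] else [])"

text \<open>Height sequences are indexed from 1, whereas lists are indexed from 0.\<close>

definition entry :: "nat list \<Rightarrow> nat \<Rightarrow> nat" where
  "entry hs i = hs ! (i - 1)"

definition dom_le :: "nat list \<Rightarrow> nat list \<Rightarrow> bool" where
  "dom_le hs hs' \<longleftrightarrow>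
     length hs' \<le> length hs \<and> (\<forall>i\<in>{1..length hs'}. entry hs i \<le> entry hs' i)"

definition dyckB_order :: "nat \<Rightarrow> step list gorder" where
  "dyckB_order n =
     \<lparr>carrier = dyckB n, eq = (=), le = (\<lambda>w w'. dom_le (heights w) (heights w'))\<rparr>"

definition is_rel_pseudocomplement :: "('a, 'b) gorder_scheme \<Rightarrow> 'a \<Rightarrow> 'a \<Rightarrow> 'a \<Rightarrow> bool" where
  "is_rel_pseudocomplement L x y p \<longleftrightarrow>
     greatest L p {z \<in> carrier L. x \<sqinter>\<^bsub>L\<^esub> z \<sqsubseteq>\<^bsub>L\<^esub> y}"

text \<open>Inserting \<open>0\<close> implements the convention that the maximum of the empty set is \<open>0\<close>.\<close>

definition rpc_length :: "nat list \<Rightarrow> nat list \<Rightarrow> nat" where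
  "rpc_length g1 g2 =
     (let k1 = length g1; k2 = length g2 in
      if k1 < k2 \<or> (k1 \<ge> k2 \<and> entry g1 k2 > entry g2 k2) then k2
      else Max (insert 0 {i \<in> {1..k2 - 1}. entry g1 i > entry g2 i}) + 1)"

text \<open>Only the values at \<open>i \<in> {1..k}\<close> with \<open>k = rpc_length g1 g2\<close> are meaningful.\<close>

function rpc_entry :: "nat \<Rightarrow> nat list \<Rightarrow> nat list \<Rightarrow> nat \<Rightarrow> nat" where
  "rpc_entry n g1 g2 i =
     (let k1 = length g1; k2 = length g2; k = rpc_length g1 g2 in
      if k1 < k2 then
        (if i \<le> k1 \<and> entry g1 i \<le> entry g2 i then rpc_entry n g1 g2 (i + 1)
         else entry g2 i)
      else
        (if i = k \<and> entry g1 k \<le> entry g2 k then 2 * n - k + 1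
         else if i < k \<and> entry g1 i \<le> entry g2 i then rpc_entry n g1 g2 (i + 1)
         else entry g2 i))"
  by pat_completeness auto
termination
  by (relation "measure (\<lambda>(n, g1, g2, i). Suc (length g1 + rpc_length g1 g2) - i)") auto

declare rpc_entry.simps [simp del]

definition rpc_heights :: "nat \<Rightarrow> nat list \<Rightarrow> nat list \<Rightarrow> nat list" where
  "rpc_heights n g1 g2 = map (rpc_entry n g1 g2) [1..<rpc_length g1 g2 + 1]"

end

theory Submission
  imports Defs
begin

text \<open>
  Heights identify Dyck paths with the sequences \<open>is_height_seq\<close>, so everything happens on
  sequences. Call \<open>i\<close> \<^emph>\<open>blocking\<close> if \<open>i > k\<^sub>1\<close> or the \<open>i\<close>-th entry of the
  first sequence exceeds that of the second. The meet with \<open>z\<close> lies below the second sequence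
  iff \<open>k\<^sub>2 \<le> max k\<^sub>1 (length z)\<close> and, at every blocking \<open>i \<le> k\<^sub>2\<close>, \<open>z\<close> itself has an \<open>i\<close>-th
  entry bounded by that of the second sequence. The formula describes the largest height sequence
  subject to these bounds: it takes them at blocking positions and otherwise repeats the entry to
  the right.
\<close>

section \<open>Heights of Dyck paths\<close>

text \<open>The \<open>Rt\<close> part of \<open>heights\<close> as a structural recursion. The
  accumulator \<open>c\<close> counts the \<open>Up\<close> steps already read, which makes the
  later inductions go through.\<close>

fun rt_heights :: "nat \<Rightarrow> step list \<Rightarrow> nat list" where
  "rt_heights c [] = []"
| "rt_heights c (Rt # w) = c # rt_heights c w"
| "rt_heights c (Up # w) = rt_heights (Suc c) w"

lemma map_count_filter_eq_rt_heights:
  "map (\<lambda>j. c + count_list (take j w) Up) (filter (\<lambda>j. w ! j = Rt) [0..<length w])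
     = rt_heights c w"
proof (induction c w rule: rt_heights.induct)
  case (1 c)
  then show ?case by simp
next
  case (2 c w)
  have "[0..<length (Rt # w)] = 0 # map Suc [0..<length w]"
    by (simp add: map_Suc_upt upt_conv_Cons del: upt_Suc)
  with 2 show ?case
    by (simp add: filter_map o_def del: upt_Suc)
next
  case (3 c w)
  have "[0..<length (Up # w)] = 0 # map Suc [0..<length w]"
    by (simp add: map_Suc_upt upt_conv_Cons del: upt_Suc)
  with 3 show ?case
    by (simp add: filter_map o_def del: upt_Suc)
qed

lemma heights_eq_rt_heights:
  "heights w = rt_heights 0 w @ (if w \<noteq> [] \<and> last w = Up then [count_list w Up] else [])"
  using map_count_filter_eq_rt_heights[of 0 w] by (simp add: heights_def)

lemma length_rt_heights: "length (rt_heights c w) = count_list w Rt"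
  by (induction c w rule: rt_heights.induct) auto

lemma count_Up_plus_count_Rt: "count_list w Up + count_list w Rt = length w"
proof (induction w)
  case (Cons x w)
  then show ?case by (cases x) auto
qed simp

lemma rt_heights_append:
  "rt_heights c (v @ w) = rt_heights c v @ rt_heights (c + count_list v Up) w"
  by (induction c v rule: rt_heights.induct) auto

lemma set_rt_heights_subset: "set (rt_heights c w) \<subseteq> {c..c + count_list w Up}"
  by (induction c w rule: rt_heights.induct) fastforce+

lemma sorted_rt_heights: "sorted (rt_heights c w)"
proof (induction c w rule: rt_heights.induct)
  case (2 c w)
  then show ?case using set_rt_heights_subset[of c w] by auto
qed auto

text \<open>A word starting with \<open>Rt\<close> yields \<open>c\<close> as an entry, whereas
  after a first \<open>Up\<close> all entries are at least \<open>Suc c\<close>. Trailing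
  \<open>Up\<close> steps leave no entry; the common length recovers them.\<close>

lemma rt_heights_inject:
  "\<lbrakk>rt_heights c v = rt_heights c w; length v = length w\<rbrakk> \<Longrightarrow> v = w"
proof (induction c v arbitrary: w rule: rt_heights.induct)
  case (1 c)
  then show ?case by simp
next
  case (2 c v)
  from 2(3) obtain x w' where w: "w = x # w'" by (cases w) auto
  show ?case
  proof (cases x)
    case Up
    then have "c \<in> set (rt_heights (Suc c) w')"
      using 2(2) w by (metis list.set_intros(1) rt_heights.simps(2,3))
    then show ?thesis using set_rt_heights_subset[of "Suc c" w'] by auto
  next
    case Rt
    then show ?thesis using 2 w by auto
  qed
next
  case (3 c v)
  from 3(3) obtain x w' where w: "w = x # w'" by (cases w) auto
  show ?case
  proof (cases x)
    case Rt
    then have "c \<in> set (rt_heights (Suc c) v)" using 3(2) w by simp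
    then show ?thesis using set_rt_heights_subset[of "Suc c" v] by auto
  next
    case Up
    then show ?thesis using 3 w by auto
  qed
qed

text \<open>Only the empty prefix and the prefixes ending in \<open>Rt\<close> matter. Here
  \<open>c\<close> and \<open>d\<close> stand for the \<open>Up\<close> and \<open>Rt\<close> steps
  read before \<open>w\<close>; the inequality is strict because list positions start at 0.\<close>

lemma prefix_counts_iff_rt_heights:
  "(\<forall>v. prefix v w \<longrightarrow> d + count_list v Rt \<le> c + count_list v Up) \<longleftrightarrow>
     d \<le> c \<and> (\<forall>i < length (rt_heights c w). d + i < rt_heights c w ! i)"
proof (induction c w arbitrary: d rule: rt_heights.induct)
  case (1 c)
  then show ?case by simp
next
  case (2 c w)
  have "(\<forall>v. prefix v (Rt # w) \<longrightarrow> d + count_list v Rt \<le> c + count_list v Up) \<longleftrightarrow>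
      d \<le> c \<and> (\<forall>v. prefix v w \<longrightarrow> Suc d + count_list v Rt \<le> c + count_list v Up)"
    by (auto simp: prefix_Cons)
  also have "\<dots> \<longleftrightarrow> d \<le> c \<and> Suc d \<le> c
      \<and> (\<forall>i < length (rt_heights c w). Suc d + i < rt_heights c w ! i)"
    using 2[of "Suc d"] by simp
  finally show ?case
    by (auto simp: less_Suc_eq_0_disj)
next
  case (3 c w)
  have "(\<forall>v. prefix v (Up # w) \<longrightarrow> d + count_list v Rt \<le> c + count_list v Up) \<longleftrightarrow>
      d \<le> c \<and> (\<forall>v. prefix v w \<longrightarrow> d + count_list v Rt \<le> Suc c + count_list v Up)"
    by (auto simp: prefix_Cons)
  also have "\<dots> \<longleftrightarrow> d \<le> c \<and> d \<le> Suc c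
      \<and> (\<forall>i < length (rt_heights (Suc c) w). d + i < rt_heights (Suc c) w ! i)"
    using 3[of d] by simp
  finally show ?case by auto
qed

lemma dyckB_iff_rt_heights:
  "w \<in> dyckB n \<longleftrightarrow> length w = 2 * n \<and> (\<forall>i < length (rt_heights 0 w). i < rt_heights 0 w ! i)"
  using prefix_counts_iff_rt_heights[of w 0 0] by (simp add: dyckB_def)

section \<open>Numerical characterisation of height sequences\<close>

definition is_height_seq :: "nat \<Rightarrow> nat list \<Rightarrow> bool" where
  "is_height_seq n g \<longleftrightarrow> length g \<in> {1..n} \<and>
     entry g (length g) \<in> {2 * n - length g, 2 * n - length g + 1} \<and>
     (\<forall>i \<in> {1..<length g}. entry g i \<le> entry g (i + 1) \<and> entry g i \<le> 2 * n - length g) \<and>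
     (\<forall>i \<in> {1..length g}. i \<le> entry g i)"

lemma is_height_seqI:
  assumes "length g \<in> {1..n}" "last g \<in> {2 * n - length g, 2 * n - length g + 1}" "sorted g"
    and "\<And>x. x \<in> set (butlast g) \<Longrightarrow> x \<le> 2 * n - length g"
    and "\<And>i. i < length g \<Longrightarrow> i < g ! i"
  shows "is_height_seq n g"
proof -
  have "entry g i \<le> entry g (i + 1) \<and> entry g i \<le> 2 * n - length g" if "i \<in> {1..<length g}" for i
  proof
    show "entry g i \<le> entry g (i + 1)"
      using that \<open>sorted g\<close> by (auto simp: entry_def intro: sorted_nth_mono)
    have "butlast g ! (i - 1) \<in> set (butlast g)" using that by (intro nth_mem) auto
    moreover have "butlast g ! (i - 1) = g ! (i - 1)" using that by (intro nth_butlast) auto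
    ultimately show "entry g i \<le> 2 * n - length g" using assms(4) by (simp add: entry_def)
  qed
  moreover have "i \<le> entry g i" if "i \<in> {1..length g}" for i
  proof -
    have "i - 1 < g ! (i - 1)" using that by (intro assms(5)) auto
    then show ?thesis by (simp add: entry_def)
  qed
  moreover have "last g = entry g (length g)"
    using assms(1) by (cases g) (auto simp: entry_def last_conv_nth)
  ultimately show ?thesis
    using assms(1,2) by (simp add: is_height_seq_def)
qed

lemma is_height_seq_length:
  assumes "is_height_seq n g"
  shows "1 \<le> length g" "length g \<le> n"
  using assms by (auto simp: is_height_seq_def)

lemma is_height_seq_not_Nil: "is_height_seq n g \<Longrightarrow> g \<noteq> []"
  by (auto simp: is_height_seq_def)

lemma is_height_seq_entry_mono:
  assumes "is_height_seq n g" "1 \<le> i" "i \<le> j" "j \<le> length g"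
  shows "entry g i \<le> entry g j"
  using assms(3,4)
proof (induction rule: dec_induct)
  case (step m)
  then have "entry g m \<le> entry g (m + 1)" using assms(1,2) by (simp add: is_height_seq_def)
  with step show ?case by simp
qed simp

lemma is_height_seq_entry_le:
  assumes "is_height_seq n g" "1 \<le> i" "i < length g"
  shows "entry g i \<le> 2 * n - length g"
  using assms by (simp add: is_height_seq_def)

lemma is_height_seq_entry_ge:
  assumes "is_height_seq n g" "1 \<le> i" "i \<le> length g"
  shows "i \<le> entry g i"
  using assms by (simp add: is_height_seq_def)

lemma is_height_seq_entry_length:
  assumes "is_height_seq n g"
  shows "entry g (length g) = 2 * n - length g \<or> entry g (length g) = 2 * n - length g + 1"
  using assms by (auto simp: is_height_seq_def)

lemma is_height_seq_entry_le_Suc: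
  assumes "is_height_seq n g" "1 \<le> i" "i \<le> length g"
  shows "entry g i \<le> 2 * n - length g + 1"
  using is_height_seq_entry_mono[OF assms le_refl] is_height_seq_entry_length[OF assms(1)] by auto

text \<open>Split off the last step, \<open>w = v @ [x]\<close>. For either value of
  \<open>x\<close> the sequence has length \<open>k = count_list v Rt + 1\<close>, so
  \<open>v\<close> contains exactly \<open>2 * n - k\<close> steps \<open>Up\<close>. This bounds
  all entries but the last and leaves two values for the last one.\<close>

lemma is_height_seq_heights:
  assumes "n \<ge> 1" "w \<in> dyckB n"
  shows "is_height_seq n (heights w)"
proof -
  have len: "length w = 2 * n"
    and low: "\<And>i. i < length (rt_heights 0 w) \<Longrightarrow> i < rt_heights 0 w ! i"
    using assms(2) by (auto simp: dyckB_iff_rt_heights)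
  then have "w \<noteq> []" using assms(1) by auto
  then obtain v x where w: "w = v @ [x]" by (metis append_butlast_last_id)
  have cnt: "count_list v Up + count_list v Rt + 1 = 2 * n"
    using len w count_Up_plus_count_Rt[of v] by simp
  have v_low: "count_list v Rt \<le> count_list v Up"
    using assms(2) w by (auto simp: dyckB_def)
  note v = length_rt_heights[of 0 v] set_rt_heights_subset[of 0 v] sorted_rt_heights[of 0 v]
  show ?thesis
  proof (cases x)
    case Rt
    have "count_list v Rt + 1 \<le> count_list v Up"
      using assms(2) w Rt by (auto simp: dyckB_def)
    then have v_len: "count_list v Rt + 1 \<le> n" using cnt by simp
    from Rt have h: "heights w = rt_heights 0 v @ [count_list v Up]" "heights w = rt_heights 0 w"
      by (simp_all add: w heights_eq_rt_heights rt_heights_append)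
    show ?thesis
    proof (rule is_height_seqI)
      show "i < heights w ! i" if "i < length (heights w)" for i
        using low that unfolding h(2) .
    qed (use v cnt v_len in \<open>auto simp: h(1) sorted_append\<close>)
  next
    case Up
    then have h: "heights w = rt_heights 0 v @ [count_list v Up + 1]"
        "rt_heights 0 w = rt_heights 0 v"
      by (simp_all add: w heights_eq_rt_heights rt_heights_append)
    show ?thesis
    proof (rule is_height_seqI)
      show "i < heights w ! i" if "i < length (heights w)" for i
        using low[of i] that v(1) v_low unfolding h by (auto simp: nth_append less_Suc_eq)
    qed (use v cnt v_low in \<open>fastforce simp: h(1) sorted_append\<close>)+
  qed
qed

text \<open>Length plus last entry is \<open>2 * n\<close> or \<open>2 * n + 1\<close> according to
  the final step, so equal heights force equal final steps. Then \<open>rt_heights_inject\<close>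
  applies.\<close>

lemma heights_inject:
  assumes "n \<ge> 1" "length v = 2 * n" "length w = 2 * n" "heights v = heights w"
  shows "v = w"
proof -
  have *: "length (heights w) + last (heights w) = (if last w = Up then 2 * n + 1 else 2 * n)"
    if l: "length w = 2 * n" for w
  proof -
    have "w \<noteq> []" using l assms(1) by auto
    then obtain v x where w: "w = v @ [x]" by (metis append_butlast_last_id)
    show ?thesis
      using l count_Up_plus_count_Rt[of v]
      by (cases x) (auto simp: w heights_eq_rt_heights rt_heights_append length_rt_heights)
  qed
  have "last v = Up \<longleftrightarrow> last w = Up"
    using *[of v] *[of w] assms by (auto split: if_splits)
  moreover have "v \<noteq> []" "w \<noteq> []" using assms by auto
  ultimately have "rt_heights 0 v = rt_heights 0 w"
    using assms(4) by (auto simp: heights_eq_rt_heights split: if_splits)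
  then show ?thesis using assms(2,3) by (intro rt_heights_inject) auto
qed

section \<open>Reconstruction of a path from its height sequence\<close>

fun word_of_heights :: "nat \<Rightarrow> nat \<Rightarrow> nat list \<Rightarrow> step list" where
  "word_of_heights c m [] = replicate (m - c) Up"
| "word_of_heights c m (h # hs) = replicate (h - c) Up @ Rt # word_of_heights h m hs"

lemma rt_heights_replicate_Up: "rt_heights c (replicate j Up) = []"
  by (induction j arbitrary: c) auto

lemma count_list_replicate: "count_list (replicate j x) y = (if x = y then j else 0)"
  by (induction j) auto

text \<open>Sortedness keeps the subtractions \<open>h - c\<close> in \<open>word_of_heights\<close>
  from truncating.\<close>

lemma rt_heights_word_of_heights:
  "sorted (c # hs) \<Longrightarrow> rt_heights c (word_of_heights c m hs) = hs"
  by (induction c m hs rule: word_of_heights.induct)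
    (auto simp: rt_heights_append rt_heights_replicate_Up count_list_replicate)

lemma count_Up_word_of_heights:
  "sorted (c # hs @ [m]) \<Longrightarrow> c + count_list (word_of_heights c m hs) Up = m"
proof (induction c m hs rule: word_of_heights.induct)
  case (2 c m h hs)
  then show ?case by (auto simp: count_list_replicate add.assoc[symmetric])
qed (simp add: count_list_replicate)

text \<open>The closing block of \<open>Up\<close> steps is nonempty exactly when the last entry is
  still below the total \<open>m\<close>.\<close>

lemma last_word_of_heights:
  assumes "sorted (c # hs @ [m])" "hs \<noteq> [] \<or> c < m"
  shows "word_of_heights c m hs \<noteq> [] \<and>
    last (word_of_heights c m hs) = (if last (c # hs) < m then Up else Rt)"
  using assms
proof (induction c m hs rule: word_of_heights.induct)
  case (2 c m h hs)
  then show ?case by (cases "hs \<noteq> [] \<or> h < m") auto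
qed auto

lemma ex_dyckB_heights_eq:
  assumes g: "is_height_seq n g"
  shows "\<exists>w \<in> dyckB n. heights w = g"
proof -
  note len = is_height_seq_length[OF g]
  then have ne: "g \<noteq> []" by auto
  have last: "last g = entry g (length g)" using ne by (simp add: entry_def last_conv_nth)
  have srt: "sorted g"
    unfolding sorted_iff_nth_mono
  proof (intro allI impI)
    fix i j assume "i \<le> j" "j < length g"
    then show "g ! i \<le> g ! j"
      using is_height_seq_entry_mono[OF g, of "Suc i" "Suc j"] by (simp add: entry_def)
  qed
  have low: "i < g ! i" if "i < length g" for i
    using is_height_seq_entry_ge[OF g, of "Suc i"] that by (simp add: entry_def)
  have le: "x \<le> 2 * n - length g" if x: "x \<in> set (butlast g)" for x
  proof -
    from x obtain i where "i < length g - 1" "x = butlast g ! i"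
      by (auto simp: in_set_conv_nth)
    then show ?thesis
      using is_height_seq_entry_le[OF g, of "Suc i"] by (simp add: entry_def nth_butlast)
  qed
  define m where "m = last g"
  \<comment> \<open>A last entry \<open>2 * n - length g\<close> belongs to a path ending in
    \<open>Rt\<close>, where every entry comes from an \<open>Rt\<close>. Otherwise the last entry
    is the total number of \<open>Up\<close> steps, which \<open>heights\<close> appends for a path
    ending in \<open>Up\<close>.\<close>
  define hs where "hs = (if m = 2 * n - length g then g else butlast g)"
  define w where "w = word_of_heights 0 m hs"
  have g_eq: "butlast g @ [m] = g" using ne by (simp add: m_def)
  have m: "m = 2 * n - length g \<or> m = 2 * n - length g + 1"
    using is_height_seq_entry_length[OF g] last m_def by auto
  have sorted_hs: "sorted (0 # hs @ [m])"
  proof (cases "m = 2 * n - length g")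
    case True
    have "\<And>x. x \<in> set (butlast g @ [m]) \<Longrightarrow> x \<le> m" using le True by auto
    then have "\<And>x. x \<in> set g \<Longrightarrow> x \<le> m" unfolding g_eq .
    then show ?thesis using True srt by (auto simp: hs_def sorted_append)
  next
    case False
    then show ?thesis using srt g_eq by (simp add: hs_def)
  qed
  have rt: "rt_heights 0 w = hs"
    unfolding w_def using sorted_hs by (intro rt_heights_word_of_heights) (auto simp: sorted_append)
  have up: "count_list w Up = m"
    unfolding w_def using count_Up_word_of_heights[OF sorted_hs] by simp
  have "m > 0" using low[of "length g - 1"] ne by (simp add: m_def last_conv_nth)
  then have last_w: "w \<noteq> [] \<and> last w = (if last (0 # hs) < m then Up else Rt)"
    unfolding w_def using last_word_of_heights[OF sorted_hs] by simp
  have "length w = m + length hs"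
    using count_Up_plus_count_Rt[of w] length_rt_heights[of 0 w] rt up by simp
  also have "\<dots> = 2 * n" using m len by (auto simp: hs_def)
  finally have "length w = 2 * n" .
  moreover have "i < hs ! i" if "i < length hs" for i
    using low[of i] that by (auto simp: hs_def nth_butlast split: if_splits)
  ultimately have "w \<in> dyckB n" by (simp add: dyckB_iff_rt_heights rt)
  moreover have "heights w = g"
  proof (cases "m = 2 * n - length g")
    case True
    then have "last w = Rt" using last_w ne by (simp add: hs_def m_def)
    then show ?thesis using True by (simp add: heights_eq_rt_heights rt hs_def)
  next
    case False
    \<comment> \<open>Here \<open>m = 2 * n - length g + 1\<close> exceeds every remaining entry, so
      the word ends in \<open>Up\<close>.\<close>
    then have "last (0 # hs) < m"
      using le[of "last (butlast g)"] m \<open>m > 0\<close> by (auto simp: hs_def)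
    then show ?thesis using False last_w g_eq
      by (simp add: heights_eq_rt_heights rt up hs_def)
  qed
  ultimately show ?thesis by blast
qed

section \<open>Meets in the dominance order\<close>

definition meet_heights :: "nat list \<Rightarrow> nat list \<Rightarrow> nat list" where
  "meet_heights g g' =
     map (\<lambda>i. if i < length g \<and> i < length g' then min (g ! i) (g' ! i)
              else if i < length g then g ! i else g' ! i) [0..<max (length g) (length g')]"

lemma length_meet_heights: "length (meet_heights g g') = max (length g) (length g')"
  by (simp add: meet_heights_def)

lemma entry_meet_heights:
  assumes "1 \<le> i" "i \<le> max (length g) (length g')"
  shows "entry (meet_heights g g') i =
    (if i \<le> length g \<and> i \<le> length g' then min (entry g i) (entry g' i)
     else if i \<le> length g then entry g i else entry g' i)"
  using assms by (auto simp: entry_def meet_heights_def Suc_le_eq)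

lemma meet_heights_commute: "meet_heights g g' = meet_heights g' g"
  by (auto simp: meet_heights_def max.commute min.commute)

text \<open>By symmetry let \<open>g\<close> be the longer sequence. Its bounds are inherited by the
  smaller entries, and where \<open>g'\<close> ends the meet passes from a minimum to an entry of
  \<open>g\<close>, which preserves monotonicity.\<close>

lemma is_height_seq_meet_heights:
  assumes "is_height_seq n g" "is_height_seq n g'"
  shows "is_height_seq n (meet_heights g g')"
  using assms
proof (induction "length g'" "length g" arbitrary: g g' rule: linorder_wlog)
  case le
  note g = \<open>is_height_seq n g\<close> and g' = \<open>is_height_seq n g'\<close>
  note len = is_height_seq_length[OF g] is_height_seq_length[OF g']
  have max: "max (length g) (length g') = length g" using le by simp
  have e: "entry (meet_heights g g') i =
      (if i \<le> length g' then min (entry g i) (entry g' i) else entry g i)"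
    if "1 \<le> i" "i \<le> length g" for i
    using entry_meet_heights[of i g g'] that le by auto
  show ?case
    unfolding is_height_seq_def length_meet_heights max
  proof (intro conjI ballI)
    show "length g \<in> {1..n}"
      using len by auto
    show "entry (meet_heights g g') (length g) \<in> {2 * n - length g, 2 * n - length g + 1}"
      using e[of "length g"] len le is_height_seq_entry_length[OF g] is_height_seq_entry_length[OF g']
      by (cases "length g = length g'") (auto simp: min_def)
  next
    fix i assume i: "i \<in> {1..<length g}"
    then show "entry (meet_heights g g') i \<le> entry (meet_heights g g') (i + 1)"
      using e[of i] e[of "i + 1"] is_height_seq_entry_mono[OF g, of i "i + 1"]
        is_height_seq_entry_mono[OF g', of i "i + 1"] by auto
    show "entry (meet_heights g g') i \<le> 2 * n - length g"
      using e[of i] i is_height_seq_entry_le[OF g, of i] by auto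
  next
    fix i assume "i \<in> {1..length g}"
    then show "i \<le> entry (meet_heights g g') i"
      using e[of i] is_height_seq_entry_ge[OF g, of i] is_height_seq_entry_ge[OF g', of i] by auto
  qed
next
  case sym
  then show ?case using meet_heights_commute by metis
qed

lemma dom_le_antisym: "\<lbrakk>dom_le g g'; dom_le g' g\<rbrakk> \<Longrightarrow> g = g'"
proof (rule nth_equalityI)
  fix i assume "dom_le g g'" "dom_le g' g" "i < length g"
  then have "Suc i \<in> {1..length g}" "Suc i \<in> {1..length g'}" by (auto simp: dom_le_def)
  with \<open>dom_le g g'\<close> \<open>dom_le g' g\<close> have "entry g (Suc i) = entry g' (Suc i)"
    by (meson dom_le_def le_antisym)
  then show "g ! i = g' ! i" by (simp add: entry_def)
qed (simp add: dom_le_def)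

lemma dom_le_meet_heights_iff:
  "dom_le h (meet_heights g g') \<longleftrightarrow> dom_le h g \<and> dom_le h g'"
  unfolding dom_le_def length_meet_heights
  by (auto simp: entry_meet_heights split: if_splits)

text \<open>A minimum is below a bound iff one of its arguments is. The disjunction shows where
  \<open>g\<close> alone suffices and where \<open>g'\<close> has to supply the bound.\<close>

lemma meet_heights_dom_le_iff:
  "dom_le (meet_heights g g') h \<longleftrightarrow> length h \<le> max (length g) (length g') \<and>
     (\<forall>i \<in> {1..length h}. (i \<le> length g \<and> entry g i \<le> entry h i)
        \<or> (i \<le> length g' \<and> entry g' i \<le> entry h i))"
  unfolding dom_le_def length_meet_heights
  by (intro conj_cong refl ball_cong) (auto simp: entry_meet_heights)

text \<open>The library meet is a \<open>SOME\<close> choice among greatest lower bounds. A path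
  with heights \<open>?m\<close> is one such bound, and antisymmetry of \<open>dom_le\<close> gives
  the chosen one the same heights.\<close>

lemma heights_meet:
  assumes "n \<ge> 1" "x \<in> dyckB n" "z \<in> dyckB n"
  shows "heights (x \<sqinter>\<^bsub>dyckB_order n\<^esub> z) = meet_heights (heights x) (heights z)"
proof -
  let ?L = "dyckB_order n" and ?m = "meet_heights (heights x) (heights z)"
  have "is_height_seq n ?m"
    using assms by (intro is_height_seq_meet_heights is_height_seq_heights)
  then obtain w where w: "w \<in> dyckB n" "heights w = ?m"
    using ex_dyckB_heights_eq by blast
  have Lower: "Lower ?L {x, z} = {v \<in> dyckB n. dom_le (heights v) ?m}"
    using assms by (auto simp: Lower_def dyckB_order_def dom_le_meet_heights_iff)
  have "greatest ?L w (Lower ?L {x, z})"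
    using w unfolding greatest_def Lower by (auto simp: dyckB_order_def dom_le_def)
  moreover have "x \<sqinter>\<^bsub>?L\<^esub> z = (SOME i. greatest ?L i (Lower ?L {x, z}))"
    by (simp add: meet_def inf_def)
  ultimately have "greatest ?L (x \<sqinter>\<^bsub>?L\<^esub> z) (Lower ?L {x, z})"
    by (metis someI)
  then have "dom_le (heights (x \<sqinter>\<^bsub>?L\<^esub> z)) ?m" "dom_le (heights w) (heights (x \<sqinter>\<^bsub>?L\<^esub> z))"
    using w unfolding greatest_def Lower by (auto simp: dyckB_order_def dom_le_def)
  then show ?thesis using w dom_le_antisym by auto
qed

section \<open>The relative pseudocomplement on height sequences\<close>

definition blocking :: "nat list \<Rightarrow> nat list \<Rightarrow> nat \<Rightarrow> bool" where
  "blocking a b i \<longleftrightarrow> length a < i \<or> entry b i < entry a i"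

text \<open>Replaces the \<open>Max\<close> by what the proofs use: either the last index of
  \<open>b\<close> is blocking, or no index from \<open>rpc_length a b\<close> up to
  \<open>length b\<close> is, while the one just before is blocking if it exists.\<close>

lemma rpc_length_cases:
  assumes "b \<noteq> []"
  obtains (last) "rpc_length a b = length b" "blocking a b (length b)"
  | (inner) "1 \<le> rpc_length a b" "rpc_length a b \<le> length b" "length b \<le> length a"
      "\<And>j. \<lbrakk>rpc_length a b \<le> j; j \<le> length b\<rbrakk> \<Longrightarrow> \<not> blocking a b j"
      "rpc_length a b = 1 \<or> 2 \<le> rpc_length a b \<and> blocking a b (rpc_length a b - 1)"
proof (cases "blocking a b (length b)")
  case True
  then have "rpc_length a b = length b" by (auto simp: rpc_length_def blocking_def Let_def)
  with True show ?thesis by (intro last)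
next
  case False
  define S where "S = insert 0 {i \<in> {1..length b - 1}. entry a i > entry b i}"
  have S_mem: "i \<in> S \<longleftrightarrow> i = 0 \<or> 1 \<le> i \<and> i \<le> length b - 1 \<and> entry a i > entry b i" for i
    by (auto simp: S_def)
  have k: "rpc_length a b = Max S + 1"
    using False by (auto simp: rpc_length_def blocking_def Let_def S_def)
  have fin: "finite S" "S \<noteq> {}" by (auto simp: S_def)
  then have "Max S \<in> S" by (rule Max_in)
  have len: "length b \<le> length a" "1 \<le> length b" using False assms by (auto simp: blocking_def Suc_le_eq)
  show ?thesis
  proof (rule inner)
    show "rpc_length a b \<le> length b" using \<open>Max S \<in> S\<close> len k by (auto simp: S_mem)
    show "rpc_length a b = 1 \<or> 2 \<le> rpc_length a b \<and> blocking a b (rpc_length a b - 1)"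
      using \<open>Max S \<in> S\<close> unfolding k
      by (cases "Max S = 0") (auto simp: S_mem blocking_def)
    show "\<not> blocking a b j" if "rpc_length a b \<le> j" "j \<le> length b" for j
    proof
      assume "blocking a b j"
      with False that len have "j \<in> S" by (cases "j = length b") (auto simp: S_mem blocking_def k)
      then have "j \<le> Max S" using fin by simp
      with that k show False by simp
    qed
  qed (use k len in auto)
qed

lemma rpc_length_bounds:
  assumes "b \<noteq> []"
  shows "1 \<le> rpc_length a b" "rpc_length a b \<le> length b"
  using assms by (cases rule: rpc_length_cases[OF assms, of a]; auto simp: Suc_le_eq)+

text \<open>The two recursions of the formula merge: if \<open>length a < length b\<close>, then
  \<open>rpc_length a b = length b\<close> is itself blocking, so the value
  \<open>2 * n - i + 1\<close> never arises.\<close>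

lemma rpc_entry_eq:
  assumes "b \<noteq> []" "i \<le> rpc_length a b"
  shows "rpc_entry n a b i =
    (if blocking a b i then entry b i
     else if i = rpc_length a b then 2 * n - i + 1
     else rpc_entry n a b (i + 1))"
proof -
  have "rpc_length a b = length b" if "length a < length b"
    using that by (simp add: rpc_length_def)
  then show ?thesis
    using assms(2) rpc_length_bounds[OF assms(1), of a]
    by (subst rpc_entry.simps) (auto simp: Let_def blocking_def)
qed

section \<open>The formula yields a height sequence\<close>

lemma length_rpc_heights: "length (rpc_heights n a b) = rpc_length a b"
  by (simp add: rpc_heights_def)

lemma entry_rpc_heights:
  "\<lbrakk>1 \<le> i; i \<le> rpc_length a b\<rbrakk> \<Longrightarrow> entry (rpc_heights n a b) i = rpc_entry n a b i"
  by (simp add: entry_def rpc_heights_def nth_append del: upt_Suc)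

text \<open>Downward induction: repeating the entry to the right is harmless since \<open>b\<close>
  is increasing, and \<open>2 * n - k + 1\<close> at \<open>k = rpc_length a b\<close> dominates
  every entry of \<open>b\<close> because \<open>k\<close> is at most
  \<open>length b\<close>.\<close>

lemma entry_le_rpc_entry:
  assumes b: "is_height_seq n b" and i: "1 \<le> i" "i \<le> rpc_length a b"
  shows "entry b i \<le> rpc_entry n a b i"
  using i(2)
proof (induction rule: inc_induct)
  note ne = is_height_seq_not_Nil[OF b]
  note k = rpc_length_bounds[OF ne, of a]
  {
    case base
    then show ?case
      using rpc_entry_eq[OF ne le_refl, of n a] is_height_seq_entry_le_Suc[OF b k] k by auto
  next
    case (step m)
    then show ?case
      using rpc_entry_eq[OF ne, of m a n] is_height_seq_entry_mono[OF b, of m "Suc m"] i(1) k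
      by auto
  }
qed

lemma rpc_entry_mono:
  assumes b: "is_height_seq n b" and i: "1 \<le> i" "i < rpc_length a b"
  shows "rpc_entry n a b i \<le> rpc_entry n a b (i + 1)"
proof -
  note ne = is_height_seq_not_Nil[OF b]
  have "entry b i \<le> entry b (i + 1)"
    using i rpc_length_bounds[OF ne, of a] by (intro is_height_seq_entry_mono[OF b]) auto
  also have "\<dots> \<le> rpc_entry n a b (i + 1)" using i by (intro entry_le_rpc_entry[OF b]) auto
  finally show ?thesis using rpc_entry_eq[OF ne, of i a n] i by auto
qed

text \<open>
  A last entry \<open>2n - k + 1\<close> must strictly exceed its predecessor, so the recursion must never
  repeat it.
\<close>

lemma rpc_entry_penultimate:
  assumes a: "is_height_seq n a" and b: "is_height_seq n b" and k: "2 \<le> rpc_length a b"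
  shows "rpc_entry n a b (rpc_length a b - 1) \<le> 2 * n - rpc_length a b"
proof -
  let ?k = "rpc_length a b"
  note ne = is_height_seq_not_Nil[OF b]
  note kb = rpc_length_bounds[OF ne, of a] and la = is_height_seq_length[OF a]
    and lb = is_height_seq_length[OF b]
  have bk: "entry b (?k - 1) \<le> 2 * n - length b"
    using kb k by (intro is_height_seq_entry_le[OF b]) auto
  show ?thesis
  proof (cases "blocking a b (?k - 1)")
    case True
    then show ?thesis using rpc_entry_eq[OF ne, of "?k - 1" a n] bk kb by auto
  next
    case nb: False
    \<comment> \<open>In the \<open>inner\<close> case \<open>?k - 1\<close> would be
      blocking.\<close>
    have "?k = length b \<and> blocking a b (length b)"
      using nb k by (cases rule: rpc_length_cases[OF ne, of a]) auto
    then have kl: "?k = length b" and bl: "blocking a b (length b)" by auto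
    \<comment> \<open>Otherwise \<open>?k - 1\<close> is the last index of \<open>a\<close>, whose
      entry is at least \<open>2 * n - ?k + 1\<close>. This exceeds the bound
      \<open>2 * n - ?k\<close> for \<open>b\<close> there, making \<open>?k - 1\<close>
      blocking.\<close>
    have "length b \<le> length a"
    proof (rule ccontr)
      assume "\<not> length b \<le> length a"
      with nb kl have "length a = ?k - 1" by (auto simp: blocking_def)
      with nb bk kl show False
        using is_height_seq_entry_length[OF a] lb k by (auto simp: blocking_def)
    qed
    moreover from this have "entry a (length b) \<le> 2 * n - length a + 1"
      using lb by (intro is_height_seq_entry_le_Suc[OF a])
    moreover have "entry b (length b) < entry a (length b)"
      using bl calculation(1) by (simp add: blocking_def)
    \<comment> \<open>Being strictly below an entry that is at most
      \<open>2 * n - length b + 1\<close> rules out the larger of the two possible values.\<close>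
    ultimately have "entry b (length b) = 2 * n - length b"
      using is_height_seq_entry_length[OF b] by auto
    moreover have "rpc_entry n a b (?k - 1) = rpc_entry n a b ?k"
      using rpc_entry_eq[OF ne, of "?k - 1" a n] nb k by auto
    ultimately show ?thesis using rpc_entry_eq[OF ne, of ?k a n] bl kl by simp
  qed
qed

lemma is_height_seq_rpc_heights:
  assumes a: "is_height_seq n a" and b: "is_height_seq n b"
  shows "is_height_seq n (rpc_heights n a b)"
proof -
  let ?k = "rpc_length a b"
  note ne = is_height_seq_not_Nil[OF b]
  note k = rpc_length_bounds[OF ne, of a]
  have upper: "rpc_entry n a b i \<le> 2 * n - ?k" if i: "1 \<le> i" "i < ?k" for i
  proof -
    have "i \<le> ?k - 1" using i by simp
    \<comment> \<open>Monotonicity carries the bound at \<open>?k - 1\<close> down to all smaller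
      indices.\<close>
    then show ?thesis
    proof (induction rule: inc_induct)
      case base
      then show ?case using i by (intro rpc_entry_penultimate[OF a b]) auto
    next
      case (step m)
      then have "rpc_entry n a b m \<le> rpc_entry n a b (m + 1)"
        using i by (intro rpc_entry_mono[OF b]) auto
      with step show ?case by simp
    qed
  qed
  have last: "rpc_entry n a b ?k \<in> {2 * n - ?k, 2 * n - ?k + 1}"
  proof (cases "blocking a b ?k")
    case True
    then have "?k = length b" using k by (cases rule: rpc_length_cases[OF ne, of a]) auto
    then show ?thesis
      using True rpc_entry_eq[OF ne, of ?k a n] is_height_seq_entry_length[OF b] by auto
  next
    case False
    then show ?thesis using rpc_entry_eq[OF ne, of ?k a n] by auto
  qed
  have low: "i \<le> rpc_entry n a b i" if "1 \<le> i" "i \<le> ?k" for i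
    using is_height_seq_entry_ge[OF b, of i] entry_le_rpc_entry[OF b that] that k by auto
  show ?thesis
    unfolding is_height_seq_def length_rpc_heights
    using k is_height_seq_length(2)[OF b] last upper low rpc_entry_mono[OF b, of _ a] by (simp add: entry_rpc_heights)
qed

section \<open>The formula gives the greatest solution\<close>

lemma meet_rpc_heights_dom_le:
  assumes "b \<noteq> []"
  shows "dom_le (meet_heights a (rpc_heights n a b)) b"
  unfolding meet_heights_dom_le_iff length_rpc_heights
proof (intro conjI ballI)
  show "length b \<le> max (length a) (rpc_length a b)"
    by (cases rule: rpc_length_cases[OF assms, of a]) auto
  fix i assume i: "i \<in> {1..length b}"
  show "i \<le> length a \<and> entry a i \<le> entry b i \<or>
      i \<le> rpc_length a b \<and> entry (rpc_heights n a b) i \<le> entry b i"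
  proof (cases "blocking a b i")
    case True
    \<comment> \<open>In the \<open>inner\<close> case all blocking indices of \<open>b\<close> lie
      below \<open>rpc_length a b\<close>.\<close>
    then have "i \<le> rpc_length a b"
      using i by (cases rule: rpc_length_cases[OF assms, of a]) (auto intro: leI less_imp_le)
    then show ?thesis
      using True i rpc_entry_eq[OF assms, of i a n] by (simp add: entry_rpc_heights)
  next
    case False
    then show ?thesis by (auto simp: blocking_def)
  qed
qed

text \<open>Downward induction again: \<open>z\<close> is bounded by \<open>b\<close> at blocking
  indices, by its own next entry elsewhere, and at \<open>?k\<close> by
  \<open>2 * n - length z + 1\<close>. The last bound needs \<open>z\<close> to have length at least
  \<open>?k\<close>.\<close>

lemma dom_le_rpc_heights:
  assumes b: "is_height_seq n b" and z: "is_height_seq n z"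
    and le: "dom_le (meet_heights a z) b"
  shows "dom_le z (rpc_heights n a b)"
proof -
  let ?k = "rpc_length a b"
  note ne = is_height_seq_not_Nil[OF b]
  note k = rpc_length_bounds[OF ne, of a]
    and lb = is_height_seq_length[OF b] and lz = is_height_seq_length[OF z]
  have bl: "i \<le> length z \<and> entry z i \<le> entry b i" if "blocking a b i" "1 \<le> i" "i \<le> length b" for i
  proof -
    have "i \<in> {1..length b}" using that by simp
    with le have "i \<le> length a \<and> entry a i \<le> entry b i \<or> i \<le> length z \<and> entry z i \<le> entry b i"
      unfolding meet_heights_dom_le_iff by blast
    with that(1) show ?thesis by (auto simp: blocking_def)
  qed
  have kz: "?k \<le> length z"
  proof (cases rule: rpc_length_cases[OF ne, of a, case_names last inner])
    case last
    then show ?thesis using bl lb by simp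
  next
    case inner
    show ?thesis
    proof (rule ccontr)
      \<comment> \<open>The blocking index \<open>?k - 1\<close> must lie within \<open>z\<close>,
        so it is the last one. Its entry is then at least \<open>2 * n - ?k + 1\<close>, above the
        bound \<open>2 * n - length b\<close> for \<open>b\<close>: this is why the length is one
        more than the last blocking index.\<close>
      assume "\<not> ?k \<le> length z"
      with inner lz have "blocking a b (?k - 1)" "2 \<le> ?k" by auto
      then have "?k - 1 \<le> length z" "entry z (?k - 1) \<le> entry b (?k - 1)"
        using bl[of "?k - 1"] k by auto
      moreover have "entry b (?k - 1) \<le> 2 * n - length b"
        using k \<open>2 \<le> ?k\<close> by (intro is_height_seq_entry_le[OF b]) auto
      moreover have "length z = ?k - 1" using \<open>\<not> ?k \<le> length z\<close> calculation(1) by simp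
      ultimately show False
        using is_height_seq_entry_length[OF z] k lb \<open>2 \<le> ?k\<close> by auto
    qed
  qed
  have "entry z i \<le> rpc_entry n a b i" if i: "1 \<le> i" "i \<le> ?k" for i
    using i(2)
  proof (induction rule: inc_induct)
    case base
    show ?case
      using rpc_entry_eq[OF ne, of ?k a n] bl[of ?k] is_height_seq_entry_le_Suc[OF z k(1) kz] k kz
      by auto
  next
    case (step m)
    then show ?case
      using rpc_entry_eq[OF ne, of m a n] bl[of m] is_height_seq_entry_mono[OF z, of m "Suc m"]
        i(1) k kz by auto
  qed
  then show ?thesis using kz by (auto simp: dom_le_def length_rpc_heights entry_rpc_heights)
qed

theorem theorem3p12:
  fixes n :: nat and p1 p2 :: "step list"
  assumes "n \<ge> 1" and "p1 \<in> dyckB n" and "p2 \<in> dyckB n"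
  shows "\<exists>p \<in> dyckB n.
           heights p = rpc_heights n (heights p1) (heights p2) \<and>
           (\<forall>q \<in> dyckB n. heights q = rpc_heights n (heights p1) (heights p2) \<longrightarrow> q = p) \<and>
           is_rel_pseudocomplement (dyckB_order n) p1 p2 p"
proof -
  let ?L = "dyckB_order n"
  note h1 = is_height_seq_heights[OF assms(1,2)] and h2 = is_height_seq_heights[OF assms(1,3)]
  note ne = is_height_seq_not_Nil[OF h2]
  obtain p where p: "p \<in> dyckB n" "heights p = rpc_heights n (heights p1) (heights p2)"
    using ex_dyckB_heights_eq[OF is_height_seq_rpc_heights[OF h1 h2]] by blast
  \<comment> \<open>The candidates are rewritten in terms of height sequences, where the two
    preceding lemmas give membership and maximality.\<close>
  have "{z \<in> carrier ?L. p1 \<sqinter>\<^bsub>?L\<^esub> z \<sqsubseteq>\<^bsub>?L\<^esub> p2} =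
      {z \<in> dyckB n. dom_le (meet_heights (heights p1) (heights z)) (heights p2)}"
    using heights_meet[OF assms(1,2)] by (auto simp: dyckB_order_def)
  then have "is_rel_pseudocomplement ?L p1 p2 p"
    using p meet_rpc_heights_dom_le[OF ne] dom_le_rpc_heights[OF h2] is_height_seq_heights[OF assms(1)]
    unfolding is_rel_pseudocomplement_def greatest_def by (auto simp: dyckB_order_def)
  moreover have "q = p" if "q \<in> dyckB n" "heights q = heights p" for q
    using heights_inject[OF assms(1), of q p] that p by (simp add: dyckB_def)
  ultimately show ?thesis using p by metis
qed

end
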